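(* Let $(S_n(\omega))_{n=0}^\infty$ be a Sheffer sequence over $V$ with generating function $$\sum_{n=0}^\infty\frac1{n!}\langle S_n(\omega),v^{\otimes n}\rangle=\exp\big[\langle\omega,B(v)\rangle+\alpha(v)\big],\quad\omega\in V^*,$$ where $B(v)=\sum_{k=1}^\infty\frac1{k!}\tilde B_kv^{\otimes k}\in\mathcal F_1(V)$ and $\alpha(v)=\sum_{k=1}^\infty\frac1{k!}\langle\tilde\alpha_k,v^{\otimes k}\rangle\in\mathcal F(V,\mathbb F)$. Then, for any $\omega\in V^*$, $n\in\mathbb N$, and $v_1,\dots,v_n\in V$, $$\langle S_n(\omega),v_1\odot\dots\odot v_n\rangle=\sum_{\pi\in\mathcal P(n)}\prod_{\mathcal A\in\pi}\Big(\big\langle\omega,\tilde B_{|\mathcal A|}\big(\underset{i\in\mathcal A}\odot v_i\big)\big\rangle+\big\langle\tilde\alpha_{|\mathcal A|},\underset{i\in\mathcal A}\odot v_i\big\rangle\Big).$$ In particular, for $\omega\in V^*$, $v\in V$, and $n\in\mathbb N$, $$\langle S_n(\omega),v^{\otimes n}\rangle=\sum_{\pi\in\mathcal P(n)}\prod_{\mathcal A\in\pi}\big(\langle\omega,\tilde B_{|\mathcal A|}v^{\otimes|\mathcal A|}\rangle+\langle\tilde\alpha_{|\mathcal A|},v^{\otimes|\mathcal A|}\rangle\big).$$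
   Context: $\mathbb F=\mathbb R$ or $\mathbb C$; $V$ is a vector space over $\mathbb F$ (of any dimension); $V^*$ is its algebraic dual; $\langle\cdot,\cdot\rangle$ denotes the dual pairing (also between $(V^{\odot n})^*$ and $V^{\odot n}$). $\mathbb N=\{1,2,\dots\}$. $\mathcal L(U,W)$ is the space of linear operators. $V^{\odot n}$ is the $n$th algebraic symmetric tensor power of $V$, the linear span of the vectors $v_1\odot\dots\odot v_n=\frac1{n!}\sum_{\pi\in S_n}v_{\pi(1)}\otimes\dots\otimes v_{\pi(n)}$ (equivalently, of the vectors $v^{\otimes n}$); $V^{\odot0}=\mathbb F$, $v^{\otimes0}=1$. $\mathcal P(n)$ denotes the collection of all set partitions of $\{1,\dots,n\}$ (unordered collections of disjoint nonempty subsets with union $\{1,\dots,n\}$); $|\mathcal A|$ is the number of elements of a part $\mathcal A$. Polynomials: $\mathcal P(V^* )$ is the space of functions $p:V^*\to\mathbb F$, $p(\omega)=\sum_{k=0}^n\langle\omega^{\otimes k},f_k\rangle$, $f_k\in V^{\odot k}$, where $\langle\omega^{\otimes k},v_1\odot\dots\odot v_k\rangle=\prod_i\langle\omega,v_i\rangle$, $\omega^{\otimes 0}=1$. A polynomial sequence over $V$ is a sequence of maps $\omega\mapsto S_n(\omega)\in(V^{\odot n})^*$, $n=0,1,2,\dots$, of the form $\langle S_n(\omega),f_n\rangle=\sum_{k=0}^n\langle\omega^{\otimes k},S_{kn}f_n\rangle$, $f_n\in V^{\odot n}$, with $S_{kn}\in\mathcal L(V^{\odot n},V^{\odot k})$ and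 each $S_{nn}$ bijective. It is a Sheffer sequence if its generating function $\sum_n\frac1{n!}\langle S_n(\omega),v^{\otimes n}\rangle$ equals $\exp[\langle\omega,B(v)\rangle]A(v)$ with $B(v)\in\mathcal F_1(V)$ and $A(v)\in\mathcal F_0(V)$; when $A(0)=1$ one sets $\alpha(v)=\log A(v)$, $\alpha(0)=0$, giving the form in the claim. Formal tensor power series: $\mathcal F(V,W)$ is the set of formal series $A(v)=A_0+\sum_{n\ge1}A_nv^{\otimes n}$ with $A_0\in W$, $A_n\in\mathcal L(V^{\odot n},W)$, identified with the coefficient sequence; for $W=\mathbb F$ one writes $\langle A_n,v^{\otimes n}\rangle$. Products in $\mathcal F(V,\mathbb F)$ are determined by $\langle A_m,v^{\otimes m}\rangle\langle A_n,v^{\otimes n}\rangle=\langle A_m\odot A_n,v^{\otimes(m+n)}\rangle$; $\langle\omega,B(v)\rangle=\sum_n\langle\omega,B_nv^{\otimes n}\rangle$; $\exp[C(v)]=\sum_{k\ge0}\frac1{k!}C(v)^k$ when $C(0)=0$, and equalities are coefficientwise. $\mathcal F_0(V)$ is the set of $A(v)\in\mathcal F(V,\mathbb F)$ with $A(0)\ne0$; $\mathcal F_1(V)$ is the set of $B(v)=\sum_{n\ge1}B_nv^{\otimes n}\in\mathcal F(V,V)$ with $B(0)=0$ and $B_1\in\mathcal L(V,V)$ invertible. *)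

theory Defs
  imports
    Complex_Main
    "HOL-Library.Function_Algebras"
    "HOL-Library.Disjoint_Sets"
    "HOL-Combinatorics.Permutations"
begin

section \<open>Tensor powers\<close>

text \<open>
  The underlying set of V is the type \<open>'v\<close>, with scalar multiplication \<open>scale\<close>.  To let the ground
  field be the reals or the complex numbers, take it in class \<open>real_normed_field\<close>: a
  commutative field extension of the reals with a multiplicative norm is, by the Gelfand-Mazur
  theorem, isomorphic to one of these two.  A map on lists of vectors is multilinear if for
  every n its restriction to lists of length n is n-linear.
\<close>

definition multilinear ::
  "('f::field \<Rightarrow> 'v::ab_group_add \<Rightarrow> 'v) \<Rightarrow> ('f \<Rightarrow> 'w::ab_group_add \<Rightarrow> 'w) \<Rightarrow> ('v list \<Rightarrow> 'w) \<Rightarrow> bool"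
  where "multilinear scale scaleW M \<longleftrightarrow>
    (\<forall>xs ys. Vector_Spaces.linear scale scaleW (\<lambda>v. M (xs @ v # ys)))"

definition dual :: "('f::field \<Rightarrow> 'v::ab_group_add \<Rightarrow> 'v) \<Rightarrow> ('v \<Rightarrow> 'f) set"
  where "dual scale = {\<omega>. Vector_Spaces.linear scale (*) \<omega>}"

text \<open>
  Tensors are realised as functionals on multilinear forms: a decomposable tensor
  \<open>v\<^sub>1 \<otimes> \<dots> \<otimes> v\<^sub>n\<close> is evaluation at \<open>[v\<^sub>1, \<dots>, v\<^sub>n]\<close>, and the n-th tensor power is
  the linear span of these.  Functions that are not multilinear carry no information; every
  tensor is 0 there.  Theorem \<open>tensor_universal\<close> below shows that this span has the universal
  property of the algebraic tensor power, in any dimension.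
\<close>

type_synonym ('v, 'f) tensor = "('v list \<Rightarrow> 'f) \<Rightarrow> 'f"

definition tscale :: "'f::field \<Rightarrow> ('v, 'f) tensor \<Rightarrow> ('v, 'f) tensor"
  where "tscale c t = (\<lambda>M. c * t M)"

definition tensor :: "('f::field \<Rightarrow> 'v::ab_group_add \<Rightarrow> 'v) \<Rightarrow> 'v list \<Rightarrow> ('v, 'f) tensor"
  where "tensor scale vs = (\<lambda>M. if multilinear scale (*) M then M vs else 0)"

definition tpow :: "('f::field \<Rightarrow> 'v::ab_group_add \<Rightarrow> 'v) \<Rightarrow> nat \<Rightarrow> 'v \<Rightarrow> ('v, 'f) tensor"
  where "tpow scale n v = tensor scale (replicate n v)"

text \<open>\<open>v\<^sub>1 \<odot> \<dots> \<odot> v\<^sub>n\<close>\<close>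

definition sym_tensor ::
  "('f::field_char_0 \<Rightarrow> 'v::ab_group_add \<Rightarrow> 'v) \<Rightarrow> 'v list \<Rightarrow> ('v, 'f) tensor"
  where "sym_tensor scale vs = tscale (1 / fact (length vs))
    (\<Sum>\<pi> | \<pi> permutes {..<length vs}. tensor scale (permute_list \<pi> vs))"

text \<open>
  The order in which the index set is enumerated is irrelevant, \<open>\<odot>\<close> being symmetric.
\<close>

definition sym_tensor_on ::
  "('f::field_char_0 \<Rightarrow> 'v::ab_group_add \<Rightarrow> 'v) \<Rightarrow> nat set \<Rightarrow> (nat \<Rightarrow> 'v) \<Rightarrow> ('v, 'f) tensor"
  where "sym_tensor_on scale A v = sym_tensor scale (map v (sorted_list_of_set A))"

definition Sym :: "('f::field_char_0 \<Rightarrow> 'v::ab_group_add \<Rightarrow> 'v) \<Rightarrow> nat \<Rightarrow> ('v, 'f) tensor set"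
  where "Sym scale n = module.span tscale {sym_tensor scale vs | vs. length vs = n}"

text \<open>
  Linear maps from a space \<open>U\<close> of tensors to \<open>W\<close>.  Values outside \<open>U\<close> are irrelevant.
\<close>

definition lin_maps ::
  "('v, 'f::field) tensor set \<Rightarrow> ('f \<Rightarrow> 'w::ab_group_add \<Rightarrow> 'w) \<Rightarrow> 'w set \<Rightarrow> (('v, 'f) tensor \<Rightarrow> 'w) set"
  where "lin_maps U scaleW W = {L.
    (\<forall>x\<in>U. L x \<in> W) \<and>
    (\<forall>x\<in>U. \<forall>y\<in>U. L (x + y) = L x + L y) \<and>
    (\<forall>c. \<forall>x\<in>U. L (tscale c x) = scaleW c (L x))}"

text \<open>
  The functional on k-fold tensors given by a k-linear form \<open>\<Phi>\<close>, that is, the one sending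
  \<open>v\<^sub>1 \<otimes> \<dots> \<otimes> v\<^sub>k\<close> to \<open>\<Phi> [v\<^sub>1, \<dots>, v\<^sub>k]\<close> (see \<open>induced_tensor\<close>).
\<close>

definition induced :: "nat \<Rightarrow> ('v list \<Rightarrow> 'f::field) \<Rightarrow> ('v, 'f) tensor \<Rightarrow> 'f"
  where "induced k \<Phi> f = f (\<lambda>vs. if length vs = k then \<Phi> vs else 0)"

text \<open>The functional \<open>\<omega>\<close> to the k-th tensor power\<close>

definition dual_pow :: "('v \<Rightarrow> 'f::field) \<Rightarrow> nat \<Rightarrow> ('v, 'f) tensor \<Rightarrow> 'f"
  where "dual_pow \<omega> k = induced k (\<lambda>vs. \<Prod>v\<leftarrow>vs. \<omega> v)"

section \<open>Formal tensor power series\<close>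

text \<open>
  A series is the sequence of its coefficients \<open>A n\<close>, linear on the n-th symmetric power.
  The 0-th symmetric power is the line spanned by \<open>tpow scale 0 v = tensor scale []\<close>, which
  plays the role of 1 in the ground field, so that the constant term of a series is
  \<open>A 0 (tensor scale [])\<close>.
\<close>

type_synonym ('v, 'f, 'w) tseries = "nat \<Rightarrow> ('v, 'f) tensor \<Rightarrow> 'w"

definition tseries ::
  "('f::field_char_0 \<Rightarrow> 'v::ab_group_add \<Rightarrow> 'v) \<Rightarrow> ('f \<Rightarrow> 'w::ab_group_add \<Rightarrow> 'w) \<Rightarrow> ('v, 'f, 'w) tseries set"
  where "tseries scale scaleW = {A. \<forall>n. A n \<in> lin_maps (Sym scale n) scaleW UNIV}"

definition const_term ::
  "('f::field \<Rightarrow> 'v::ab_group_add \<Rightarrow> 'v) \<Rightarrow> ('v, 'f, 'w) tseries \<Rightarrow> 'w"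
  where "const_term scale A = A 0 (tensor scale [])"

definition series_eq ::
  "('f::field_char_0 \<Rightarrow> 'v::ab_group_add \<Rightarrow> 'v) \<Rightarrow> ('v, 'f, 'w) tseries \<Rightarrow> ('v, 'f, 'w) tseries \<Rightarrow> bool"
  where "series_eq scale A B \<longleftrightarrow> (\<forall>n. \<forall>f\<in>Sym scale n. A n f = B n f)"

definition F0 ::
  "('f::field_char_0 \<Rightarrow> 'v::ab_group_add \<Rightarrow> 'v) \<Rightarrow> ('v, 'f, 'f) tseries set"
  where "F0 scale = {A \<in> tseries scale (*). const_term scale A \<noteq> 0}"

text \<open>
  V is identified with its first symmetric power, so the linear operator \<open>B\<^sub>1\<close> on V is
  \<open>\<lambda>v. B 1 (tpow scale 1 v)\<close>.
\<close>

definition F1 ::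
  "('f::field_char_0 \<Rightarrow> 'v::ab_group_add \<Rightarrow> 'v) \<Rightarrow> ('v, 'f, 'v) tseries set"
  where "F1 scale = {B \<in> tseries scale scale.
    const_term scale B = 0 \<and> bij (\<lambda>v. B 1 (tpow scale 1 v))}"

text \<open>
  \<open>sym_prod scale m n a b\<close> is the functional \<open>a \<odot> b\<close> on the (m+n)-th symmetric power, which is
  determined by its value \<open>a (v\<^sup>m) b (v\<^sup>n)\<close> at the (m+n)-th tensor power of v
  (see \<open>sym_prod_tpow\<close>).
\<close>

definition sym_prod ::
  "('f::field_char_0 \<Rightarrow> 'v::ab_group_add \<Rightarrow> 'v) \<Rightarrow> nat \<Rightarrow> nat \<Rightarrow>
    (('v, 'f) tensor \<Rightarrow> 'f) \<Rightarrow> (('v, 'f) tensor \<Rightarrow> 'f) \<Rightarrow> ('v, 'f) tensor \<Rightarrow> 'f"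
  where "sym_prod scale m n a b = induced (m + n)
    (\<lambda>vs. a (sym_tensor scale (take m vs)) * b (sym_tensor scale (drop m vs)))"

definition series_mult ::
  "('f::field_char_0 \<Rightarrow> 'v::ab_group_add \<Rightarrow> 'v) \<Rightarrow>
    ('v, 'f, 'f) tseries \<Rightarrow> ('v, 'f, 'f) tseries \<Rightarrow> ('v, 'f, 'f) tseries"
  where "series_mult scale A B n f = (\<Sum>k\<le>n. sym_prod scale k (n - k) (A k) (B (n - k)) f)"

definition series_one :: "('v, 'f::field, 'f) tseries"
  where "series_one n = (if n = 0 then induced 0 (\<lambda>vs. 1) else (\<lambda>f. 0))"

primrec series_power ::
  "('f::field_char_0 \<Rightarrow> 'v::ab_group_add \<Rightarrow> 'v) \<Rightarrow>
    ('v, 'f, 'f) tseries \<Rightarrow> nat \<Rightarrow> ('v, 'f, 'f) tseries"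
  where
    "series_power scale C 0 = series_one"
  | "series_power scale C (Suc k) = series_mult scale C (series_power scale C k)"

text \<open>
  Meaningful only for \<open>C\<close> without constant term.  Then the n-th coefficient of the k-th power of
  \<open>C\<close> vanishes for \<open>k > n\<close> (see \<open>series_power_eq_0\<close>), so the exponential sum is finite.
\<close>

definition series_exp ::
  "('f::field_char_0 \<Rightarrow> 'v::ab_group_add \<Rightarrow> 'v) \<Rightarrow> ('v, 'f, 'f) tseries \<Rightarrow> ('v, 'f, 'f) tseries"
  where "series_exp scale C n f = (\<Sum>k\<le>n. series_power scale C k n f / fact k)"

definition series_pairing ::
  "('v \<Rightarrow> 'f) \<Rightarrow> ('v, 'f, 'v) tseries \<Rightarrow> ('v, 'f, 'f) tseries"
  where "series_pairing \<omega> B n f = \<omega> (B n f)"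

text \<open>
  The series \<open>\<Sum>\<^bsub>k \<ge> 1\<^esub> (1 / k!) X\<^sub>k v\<^sup>k\<close>; \<open>X 0\<close> is ignored.
\<close>

definition exp_series ::
  "('f::field_char_0 \<Rightarrow> 'w::ab_group_add \<Rightarrow> 'w) \<Rightarrow> ('v, 'f, 'w) tseries \<Rightarrow> ('v, 'f, 'w) tseries"
  where "exp_series scaleW X k f = (if k = 0 then 0 else scaleW (1 / fact k) (X k f))"

section \<open>Polynomial and Sheffer sequences\<close>

definition polynomial_sequence ::
  "('f::field_char_0 \<Rightarrow> 'v::ab_group_add \<Rightarrow> 'v) \<Rightarrow> (nat \<Rightarrow> ('v \<Rightarrow> 'f) \<Rightarrow> ('v, 'f) tensor \<Rightarrow> 'f) \<Rightarrow> bool"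
  where "polynomial_sequence scale S \<longleftrightarrow>
    (\<forall>n. \<forall>\<omega>\<in>dual scale. S n \<omega> \<in> lin_maps (Sym scale n) (*) UNIV) \<and>
    (\<exists>T :: nat \<Rightarrow> nat \<Rightarrow> ('v, 'f) tensor \<Rightarrow> ('v, 'f) tensor.
      (\<forall>n. \<forall>k\<le>n. T k n \<in> lin_maps (Sym scale n) tscale (Sym scale k)) \<and>
      (\<forall>n. bij_betw (T n n) (Sym scale n) (Sym scale n)) \<and>
      (\<forall>n. \<forall>\<omega>\<in>dual scale. \<forall>f\<in>Sym scale n.
        S n \<omega> f = (\<Sum>k\<le>n. dual_pow \<omega> k (T k n f))))"

definition generating_function ::
  "(nat \<Rightarrow> ('v \<Rightarrow> 'f) \<Rightarrow> ('v, 'f) tensor \<Rightarrow> 'f::field_char_0) \<Rightarrow> ('v \<Rightarrow> 'f) \<Rightarrow> ('v, 'f, 'f) tseries"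
  where "generating_function S \<omega> n f = S n \<omega> f / fact n"

definition sheffer_sequence ::
  "('f::field_char_0 \<Rightarrow> 'v::ab_group_add \<Rightarrow> 'v) \<Rightarrow> (nat \<Rightarrow> ('v \<Rightarrow> 'f) \<Rightarrow> ('v, 'f) tensor \<Rightarrow> 'f) \<Rightarrow> bool"
  where "sheffer_sequence scale S \<longleftrightarrow>
    polynomial_sequence scale S \<and>
    (\<exists>B\<in>F1 scale. \<exists>A\<in>F0 scale. \<forall>\<omega>\<in>dual scale.
      series_eq scale (generating_function S \<omega>)
        (series_mult scale (series_exp scale (series_pairing \<omega> B)) A))"

section \<open>Adequacy of the definitions\<close>

lemma sum_apply: "(\<Sum>i\<in>A. g i) x = (\<Sum>i\<in>A. g i x)"
  by (induction A rule: infinite_finite_induct) auto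

lemma vector_space_tscale: "vector_space (tscale :: 'f::field \<Rightarrow> ('v, 'f) tensor \<Rightarrow> _)"
  by unfold_locales (auto simp: tscale_def fun_eq_iff algebra_simps)

lemma vector_space_mult: "vector_space ((*) :: 'f::field \<Rightarrow> 'f \<Rightarrow> 'f)"
  by unfold_locales (auto simp: algebra_simps)

lemma linearI':
  assumes "vector_space s" "vector_space t"
    and "\<And>x y. f (x + y) = f x + f y" "\<And>c x. f (s c x) = t c (f x)"
  shows "Vector_Spaces.linear s t f"
  using assms unfolding Vector_Spaces.linear_def module_hom_def module_hom_axioms_def
  by (simp add: module_iff_vector_space)

lemma linearD:
  assumes "Vector_Spaces.linear s t f"
  shows "vector_space s" "vector_space t" "f (x + y) = f x + f y" "f (s c x) = t c (f x)"
  using assms unfolding Vector_Spaces.linear_def module_hom_def module_hom_axioms_def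
  by auto

lemma linear_comp:
  assumes "Vector_Spaces.linear s t f" "Vector_Spaces.linear t u g"
  shows "Vector_Spaces.linear s u (\<lambda>x. g (f x))"
  using Vector_Spaces.linear_compose[OF assms] by (simp add: o_def)

theorem tensor_universal:
  fixes scale :: "'f::field \<Rightarrow> 'v::ab_group_add \<Rightarrow> 'v"
    and scaleW :: "'f \<Rightarrow> 'w::ab_group_add \<Rightarrow> 'w"
  assumes M: "multilinear scale scaleW M"
  shows "\<exists>L. Vector_Spaces.linear tscale scaleW L \<and> (\<forall>vs. L (tensor scale vs) = M vs)"
proof -
  have vsW: "vector_space scaleW"
    using M linearD(2) unfolding multilinear_def by metis
  interpret p: vector_space_pair "tscale :: 'f \<Rightarrow> ('v, 'f) tensor \<Rightarrow> _" scaleW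
    using vector_space_tscale vsW by (simp add: vector_space_pair_def)
  interpret q: vector_space_pair scaleW "(*) :: 'f \<Rightarrow> 'f \<Rightarrow> 'f"
    using vector_space_mult vsW by (simp add: vector_space_pair_def)
  obtain I where I: "I \<subseteq> range (tensor scale)" "p.vs1.independent I"
      "range (tensor scale) \<subseteq> p.vs1.span I"
    using p.vs1.maximal_independent_subset by metis
  define L where "L = p.construct I (\<lambda>t. M (inv (tensor scale) t))"
  have linL: "Vector_Spaces.linear tscale scaleW L"
    unfolding L_def by (rule p.linear_construct[OF I(2)])
  have LI: "L t = M (inv (tensor scale) t)" if "t \<in> I" for t
    unfolding L_def by (rule p.construct_basis[OF I(2) that])
  have "L (tensor scale vs) = M vs" for vs
  proof (rule ccontr)
    assume "L (tensor scale vs) \<noteq> M vs"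
    then have ne: "L (tensor scale vs) - M vs \<noteq> 0" by simp
    define d where "d = L (tensor scale vs) - M vs"
    define \<phi> where "\<phi> = q.construct {d} (\<lambda>_. 1)"
    have ind: "p.vs2.independent {d}"
      using ne by (simp add: d_def)
    have lin\<phi>: "Vector_Spaces.linear scaleW (*) \<phi>"
      unfolding \<phi>_def by (rule q.linear_construct[OF ind])
    have \<phi>d: "\<phi> d = 1" unfolding \<phi>_def by (rule q.construct_basis[OF ind]) simp
    have ml: "multilinear scale (*) (\<lambda>vs. \<phi> (M vs))"
      unfolding multilinear_def
    proof (intro allI)
      fix xs ys
      have "Vector_Spaces.linear scale scaleW (\<lambda>v. M (xs @ v # ys))"
        using M unfolding multilinear_def by blast
      from linear_comp[OF this lin\<phi>]
      show "Vector_Spaces.linear scale (*) (\<lambda>v. \<phi> (M (xs @ v # ys)))" .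
    qed
    define ev where "ev = (\<lambda>t :: ('v, 'f) tensor. t (\<lambda>vs. \<phi> (M vs)))"
    have evt: "ev (tensor scale us) = \<phi> (M us)" for us
      using ml by (simp add: ev_def tensor_def)
    have linev: "Vector_Spaces.linear tscale (*) ev"
      by (rule linearI'[OF vector_space_tscale vector_space_mult]) (auto simp: ev_def tscale_def)
    have linc: "Vector_Spaces.linear tscale (*) (\<lambda>t. \<phi> (L t))"
      by (rule linear_comp[OF linL lin\<phi>])
    interpret r: vector_space_pair "tscale :: 'f \<Rightarrow> ('v, 'f) tensor \<Rightarrow> _" "(*) :: 'f \<Rightarrow> 'f \<Rightarrow> 'f"
      using vector_space_mult vector_space_tscale by (simp add: vector_space_pair_def)
    have "ev t = \<phi> (L t)" if "t \<in> p.vs1.span I" for t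
    proof (rule r.linear_eq_on[OF linev linc that])
      fix t assume t: "t \<in> I"
      then have "tensor scale (inv (tensor scale) t) = t"
        using I(1) by (auto intro: f_inv_into_f)
      then show "ev t = \<phi> (L t)" using evt[of "inv (tensor scale) t"] LI[OF t] by simp
    qed
    then have "\<phi> (M vs) = \<phi> (L (tensor scale vs))"
      using I(3) evt by (metis rangeI subsetD)
    then have "\<phi> d = 0"
      unfolding d_def using q.linear_diff[OF lin\<phi>] by simp
    with \<phi>d show False by simp
  qed
  with linL show ?thesis by blast
qed

lemma multilinear_tensor:
  fixes scale :: "'f::field \<Rightarrow> 'v::ab_group_add \<Rightarrow> 'v"
  assumes "vector_space scale"
  shows "multilinear scale tscale (tensor scale)"
  unfolding multilinear_def
proof (intro allI linearI' assms vector_space_tscale)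
  fix xs ys :: "'v list" and x y :: 'v and c :: 'f
  show "tensor scale (xs @ (x + y) # ys) = tensor scale (xs @ x # ys) + tensor scale (xs @ y # ys)"
    by (auto simp: tensor_def fun_eq_iff multilinear_def dest: linearD)
  show "tensor scale (xs @ scale c x # ys) = tscale c (tensor scale (xs @ x # ys))"
    by (auto simp: tensor_def tscale_def fun_eq_iff multilinear_def dest: linearD)
qed

lemma permute_list_split:
  assumes "\<pi> permutes {..<Suc (length xs + length ys)}"
  shows "\<exists>xs' ys'. \<forall>v. permute_list \<pi> (xs @ v # ys) = xs' @ v # ys'"
proof -
  let ?n = "Suc (length xs + length ys)"
  obtain i where i: "i < ?n" "\<pi> i = length xs"
    using permutes_image[OF assms] by (metis imageE lessThan_iff less_Suc_eq_le le_add1)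
  have other: "\<pi> j \<noteq> length xs" if "j \<noteq> i" for j
    using i that permutes_inj[OF assms] by (metis injD)
  let ?P = "\<lambda>v. permute_list \<pi> (xs @ v # ys)"
  have nth: "?P v ! j = (xs @ v # ys) ! \<pi> j" if "j < ?n" for v j
    using that assms by (intro permute_list_nth) auto
  have same: "(xs @ v # ys) ! k = (xs @ w # ys) ! k" if "k \<noteq> length xs" for v w k
    using that by (auto simp: nth_append nth_Cons split: nat.split)
  have tk: "take i (?P v) = take i (?P w)" for v w
    by (rule nth_equalityI) (use i other nth same in auto)
  have dr: "drop (Suc i) (?P v) = drop (Suc i) (?P w)" for v w
    by (rule nth_equalityI) (use i other nth same in auto)
  have "?P v = take i (?P undefined) @ v # drop (Suc i) (?P undefined)" for v
  proof -
    have "?P v = take i (?P v) @ ?P v ! i # drop (Suc i) (?P v)"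
      using i by (intro id_take_nth_drop) simp
    also have "?P v ! i = v" using i nth by simp
    finally show ?thesis using tk dr by metis
  qed
  then show ?thesis by blast
qed

lemma multilinear_sym_tensor:
  fixes scale :: "'f::field_char_0 \<Rightarrow> 'v::ab_group_add \<Rightarrow> 'v"
  assumes vs: "vector_space scale"
  shows "multilinear scale tscale (sym_tensor scale)"
  unfolding multilinear_def
proof (intro allI)
  fix xs ys :: "'v list"
  let ?n = "Suc (length xs + length ys)"
  interpret p: vector_space_pair scale "tscale :: 'f \<Rightarrow> ('v, 'f) tensor \<Rightarrow> _"
    using vector_space_tscale vs by (simp add: vector_space_pair_def)
  have lin: "Vector_Spaces.linear scale tscale (\<lambda>v. tensor scale (permute_list \<pi> (xs @ v # ys)))"
    if \<pi>: "\<pi> permutes {..<?n}" for \<pi>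
  proof -
    obtain xs' ys' where eq: "\<And>v. permute_list \<pi> (xs @ v # ys) = xs' @ v # ys'"
      using permute_list_split[OF \<pi>] by blast
    show ?thesis using multilinear_tensor[OF vs] unfolding eq multilinear_def by blast
  qed
  have "Vector_Spaces.linear scale tscale
      (\<lambda>v. \<Sum>\<pi> | \<pi> permutes {..<?n}. tensor scale (permute_list \<pi> (xs @ v # ys)))"
    by (rule p.linear_compose_sum) (use lin in auto)
  then show "Vector_Spaces.linear scale tscale (\<lambda>v. sym_tensor scale (xs @ v # ys))"
    unfolding sym_tensor_def by (simp add: p.linear_compose_scale_right)
qed

lemma sym_tensor_in_Sym: "length vs = n \<Longrightarrow> sym_tensor scale vs \<in> Sym scale n"
  unfolding Sym_def
  using vector_space_tscale by (intro module.span_base) (auto simp: module_iff_vector_space)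

lemma sym_tensor_replicate:
  fixes scale :: "'f::field_char_0 \<Rightarrow> 'v::ab_group_add \<Rightarrow> 'v"
  shows "sym_tensor scale (replicate n v) = tpow scale n v"
proof -
  have *: "permute_list \<pi> (replicate n v) = replicate n v" if "\<pi> permutes {..<n}" for \<pi>
    using that by (metis mset_permute_list length_replicate mset_replicate replicate_length_same
        set_permute_list length_permute_list in_set_replicate)
  have "sym_tensor scale (replicate n v) =
      tscale (1 / fact n) (\<Sum>\<pi> | \<pi> permutes {..<n}. tpow scale n v)"
    unfolding sym_tensor_def tpow_def length_replicate
    by (intro arg_cong[where f = "tscale _"] sum.cong) (simp_all add: *)
  moreover have "tscale (1 / fact n) (\<Sum>\<pi> | \<pi> permutes {..<n}. tpow scale n v) M = tpow scale n v M"
    for M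
    unfolding tscale_def sum_apply using card_permutations[of "{..<n}" n] by simp
  ultimately show ?thesis by (simp add: fun_eq_iff)
qed

lemma tpow_in_Sym: "tpow scale n v \<in> Sym scale n"
  by (metis sym_tensor_replicate sym_tensor_in_Sym length_replicate)

lemma induced_tensor:
  assumes "multilinear scale (*) (\<lambda>vs. if length vs = k then \<Phi> vs else 0)" "length vs = k"
  shows "induced k \<Phi> (tensor scale vs) = \<Phi> vs"
  using assms by (simp add: induced_def tensor_def)

lemma dual_pow_sym_tensor:
  fixes scale :: "'f::field_char_0 \<Rightarrow> 'v::ab_group_add \<Rightarrow> 'v"
  assumes \<omega>: "\<omega> \<in> dual scale"
  shows "dual_pow \<omega> (length vs) (sym_tensor scale vs) = (\<Prod>v\<leftarrow>vs. \<omega> v)"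
proof -
  let ?n = "length vs"
  have \<omega>': "Vector_Spaces.linear scale (*) \<omega>" using \<omega> by (simp add: dual_def)
  have ml: "multilinear scale (*) (\<lambda>vs. if length vs = ?n then \<Prod>v\<leftarrow>vs. \<omega> v else 0)"
    unfolding multilinear_def
    by (intro allI linearI' linearD(1)[OF \<omega>'] vector_space_mult)
       (auto simp: linearD[OF \<omega>'] algebra_simps)
  have "prod_list (map \<omega> (permute_list \<pi> vs)) = prod_list (map \<omega> vs)"
    if "\<pi> permutes {..<?n}" for \<pi>
    using that by (metis mset_permute_list mset_map prod_mset_prod_list)
  then show ?thesis
    using card_permutations[of "{..<?n}" ?n]
    by (simp add: dual_pow_def induced_def sym_tensor_def tscale_def sum_apply tensor_def ml)
qed

lemma sym_prod_tpow:
  fixes scale :: "'f::field_char_0 \<Rightarrow> 'v::ab_group_add \<Rightarrow> 'v"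
  assumes vs: "vector_space scale"
    and a: "a \<in> lin_maps (Sym scale m) (*) UNIV" and b: "b \<in> lin_maps (Sym scale n) (*) UNIV"
  shows "sym_prod scale m n a b (tpow scale (m + n) v) = a (tpow scale m v) * b (tpow scale n v)"
proof -
  note ST = multilinear_sym_tensor[OF vs, unfolded multilinear_def, rule_format, THEN linearD(3)]
    multilinear_sym_tensor[OF vs, unfolded multilinear_def, rule_format, THEN linearD(4)]
  let ?\<Phi> = "\<lambda>vs. a (sym_tensor scale (take m vs)) * b (sym_tensor scale (drop m vs))"
  have aD: "y \<in> Sym scale m \<Longrightarrow> a (x + y) = a x + a y" "a (tscale c x) = c * a x"
    if "x \<in> Sym scale m" for x y c
    using a that by (auto simp: lin_maps_def)
  have bD: "y \<in> Sym scale n \<Longrightarrow> b (x + y) = b x + b y" "b (tscale c x) = c * b x"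
    if "x \<in> Sym scale n" for x y c
    using b that by (auto simp: lin_maps_def)
  have ml: "multilinear scale (*) (\<lambda>vs. if length vs = m + n then ?\<Phi> vs else 0)"
    unfolding multilinear_def
  proof (intro allI)
    fix xs ys :: "'v list"
    show "Vector_Spaces.linear scale (*)
        (\<lambda>v. if length (xs @ v # ys) = m + n then ?\<Phi> (xs @ v # ys) else 0)"
    proof (rule linearI'[OF vs vector_space_mult])
      fix x y :: 'v and c :: 'f
      show "(if length (xs @ (x + y) # ys) = m + n then ?\<Phi> (xs @ (x + y) # ys) else 0) =
          (if length (xs @ x # ys) = m + n then ?\<Phi> (xs @ x # ys) else 0) +
          (if length (xs @ y # ys) = m + n then ?\<Phi> (xs @ y # ys) else 0)"
        by (cases "length xs < m")
           (auto simp: take_Cons' drop_Cons' ST aD bD sym_tensor_in_Sym algebra_simps)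
      show "(if length (xs @ scale c x # ys) = m + n then ?\<Phi> (xs @ scale c x # ys) else 0) =
          c * (if length (xs @ x # ys) = m + n then ?\<Phi> (xs @ x # ys) else 0)"
        by (cases "length xs < m")
           (auto simp: take_Cons' drop_Cons' ST aD bD sym_tensor_in_Sym algebra_simps)
    qed
  qed
  have "sym_prod scale m n a b (tpow scale (m + n) v) = ?\<Phi> (replicate (m + n) v)"
    unfolding sym_prod_def tpow_def by (rule induced_tensor[OF ml]) simp
  then show ?thesis by (simp add: sym_tensor_replicate)
qed

lemma Sym_apply_0:
  fixes f :: "('v::ab_group_add, 'f::field_char_0) tensor"
  assumes f: "f \<in> Sym scale n"
  shows "f (\<lambda>vs. 0) = 0"
proof -
  interpret p: vector_space "tscale :: 'f \<Rightarrow> ('v, 'f) tensor \<Rightarrow> _" by (rule vector_space_tscale)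
  show ?thesis
    by (rule p.span_induct[OF f[unfolded Sym_def], where P = "\<lambda>f. f (\<lambda>vs. 0) = 0"])
       (auto simp: p.subspace_def tscale_def sym_tensor_def tensor_def sum_apply)
qed

lemma series_power_eq_0:
  fixes scale :: "'f::field_char_0 \<Rightarrow> 'v::ab_group_add \<Rightarrow> 'v"
  assumes C: "C \<in> tseries scale (*)" "const_term scale C = 0"
    and "n < k" "f \<in> Sym scale n"
  shows "series_power scale C k n f = 0"
  using assms(3,4)
proof (induction k arbitrary: n f)
  case 0
  then show ?case by simp
next
  case (Suc k)
  have st0: "C 0 (sym_tensor scale []) = 0"
    using C(2) sym_tensor_replicate[of scale 0] by (simp add: const_term_def tpow_def)
  have "sym_prod scale j (n - j) (C j) (series_power scale C k (n - j)) f = 0" if "j \<le> n" for j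
  proof -
    have "(\<lambda>vs. if length vs = j + (n - j) then C j (sym_tensor scale (take j vs)) *
        series_power scale C k (n - j) (sym_tensor scale (drop j vs)) else 0) = (\<lambda>vs. 0)"
    proof (cases "j = 0")
      case True
      then show ?thesis by (auto simp: fun_eq_iff st0)
    next
      case False
      then have "n - j < k" using Suc.prems that by linarith
      then have "series_power scale C k (n - j) (sym_tensor scale (drop j vs)) = 0"
        if "length vs = n" for vs
        by (rule Suc.IH) (simp add: sym_tensor_in_Sym that)
      then show ?thesis
        using that by (auto simp: fun_eq_iff)
    qed
    then show ?thesis
      unfolding sym_prod_def induced_def using Sym_apply_0[OF Suc.prems(2)] by simp
  qed
  then show ?case by (simp add: series_mult_def)
qed

end

theory Submission
  imports Defs "HOL-Combinatorics.Multiset_Permutations"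
begin

text \<open>
  The statement is the exponential formula of enumerative combinatorics.  Fix vectors
  \<open>v\<^sub>i\<close>, one for each index \<open>i\<close>, and attach to a scalar series \<open>A\<close> the set function
  \<open>I \<mapsto> |I|! \<langle>A\<^bsub>|I|\<^esub>, \<odot>\<^bsub>i\<in>I\<^esub> v\<^sub>i\<rangle>\<close> on finite index sets.  The factorial is there
  because it turns the product of series into the convolution over subsets,
  \<open>(f * g)(I) = \<Sum>\<^bsub>J \<subseteq> I\<^esub> f(J) g(I - J)\<close> (lemma \<open>set_coeff_mult\<close>): the symmetric tensor is the
  average over all enumerations of \<open>I\<close>, the product of the coefficients of degree \<open>m\<close> and
  \<open>n - m\<close> cuts an enumeration after \<open>m\<close> entries, and each subset \<open>J\<close> with \<open>m\<close> elements arises as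
  the initial segment of exactly \<open>m! (n - m)!\<close> enumerations.

  A set function \<open>f\<close> that vanishes on the empty set has as its k-th convolution power the sum of
  \<open>\<Prod>\<^sub>i f(J\<^sub>i)\<close> over ordered partitions of \<open>I\<close> into k nonempty blocks, that is, \<open>k!\<close> times the sum
  over unordered ones (lemma \<open>set_coeff_power\<close>).  The exponential divides by \<open>k!\<close> and sums over
  k, which leaves the sum over all partitions (theorem \<open>set_coeff_exp\<close>).

  For the exponent \<open>\<langle>\<omega>, B(v)\<rangle> + \<alpha>(v)\<close> the factorials in the set function cancel those in the
  expansions of \<open>B\<close> and \<open>\<alpha>\<close>, and for the generating function they cancel the \<open>1/n!\<close> in front of
  \<open>S\<^sub>n\<close>.  The formula for \<open>v\<^bsup>\<otimes>n\<^esup>\<close> is the case where all \<open>v\<^sub>i\<close> are equal.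
\<close>

section \<open>Symmetric tensors as averages over enumerations\<close>

lemma bij_betw_permute_list:
  assumes "distinct xs"
  shows "bij_betw (\<lambda>\<pi>. permute_list \<pi> xs) {\<pi>. \<pi> permutes {..<length xs}}
    (permutations_of_set (set xs))"
proof -
  let ?P = "{\<pi>. \<pi> permutes {..<length xs}}" and ?f = "\<lambda>\<pi>. permute_list \<pi> xs"
  have image: "?f ` ?P = permutations_of_set (set xs)"
  proof (intro equalityI subsetI)
    fix ys assume "ys \<in> permutations_of_set (set xs)"
    then have "mset ys = mset xs"
      using assms by (metis permutations_of_setD set_eq_iff_mset_eq_distinct)
    then obtain p where "p permutes {..<length xs}" "permute_list p xs = ys"
      by (rule mset_eq_permutation)
    then show "ys \<in> ?f ` ?P" by blast
  qed (use assms in auto)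
  have "card (?f ` ?P) = card ?P"
    using assms by (simp add: image card_permutations distinct_card)
  then have "inj_on ?f ?P"
    by (intro eq_card_imp_inj_on) (simp_all add: finite_permutations)
  with image show ?thesis by (simp add: bij_betw_def)
qed

text \<open>
  Indexing the average by enumerations of a set of labels, instead of permutations of positions,
  shows the symmetry of \<open>\<odot>\<close> and lets sums be split according to which labels come first.
\<close>

lemma sym_tensor_eq_sum_enumerations:
  fixes scale :: "'f::field_char_0 \<Rightarrow> 'v::ab_group_add \<Rightarrow> 'v"
  assumes "distinct xs"
  shows "sym_tensor scale (map v xs) =
    tscale (1 / fact (length xs)) (\<Sum>ys\<in>permutations_of_set (set xs). tensor scale (map v ys))"
proof -
  have "(\<Sum>\<pi> | \<pi> permutes {..<length xs}. tensor scale (permute_list \<pi> (map v xs))) =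
      (\<Sum>\<pi> | \<pi> permutes {..<length xs}. tensor scale (map v (permute_list \<pi> xs)))"
    by (intro sum.cong) (simp_all add: permute_list_map)
  also have "\<dots> = (\<Sum>ys\<in>permutations_of_set (set xs). tensor scale (map v ys))"
    by (rule sum.reindex_bij_betw[OF bij_betw_permute_list[OF assms]])
  finally show ?thesis by (simp add: sym_tensor_def)
qed

lemma sym_tensor_eq_sym_tensor_on:
  assumes "distinct xs"
  shows "sym_tensor scale (map v xs) = sym_tensor_on scale (set xs) v"
  using assms by (simp add: sym_tensor_on_def sym_tensor_eq_sum_enumerations distinct_card)

lemma sym_tensor_on_in_Sym: "finite I \<Longrightarrow> sym_tensor_on scale I v \<in> Sym scale (card I)"
  by (simp add: sym_tensor_on_def sym_tensor_in_Sym)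

lemma sym_tensor_on_const: "sym_tensor_on scale I (\<lambda>_. v) = tpow scale (card I) v"
  by (simp add: sym_tensor_on_def map_replicate_const sym_tensor_replicate)

section \<open>Products of coefficients on symmetric tensors\<close>

lemma induced_sym_tensor_on:
  fixes scale :: "'f::field_char_0 \<Rightarrow> 'v::ab_group_add \<Rightarrow> 'v"
  assumes "multilinear scale (*) (\<lambda>vs. if length vs = card I then \<Phi> vs else 0)" "finite I"
  shows "fact (card I) * induced (card I) \<Phi> (sym_tensor_on scale I v) =
    (\<Sum>ys\<in>permutations_of_set I. \<Phi> (map v ys))"
proof -
  have "fact (card I) * induced (card I) \<Phi> (sym_tensor_on scale I v) =
      (\<Sum>ys\<in>permutations_of_set I. induced (card I) \<Phi> (tensor scale (map v ys)))"
    unfolding sym_tensor_on_def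
    using assms(2)
    by (subst sym_tensor_eq_sum_enumerations)
       (simp_all add: induced_def tscale_def sum_apply)
  also have "\<dots> = (\<Sum>ys\<in>permutations_of_set I. \<Phi> (map v ys))"
    using assms(1)
    by (intro sum.cong refl induced_tensor) (simp_all add: length_finite_permutations_of_set)
  finally show ?thesis .
qed

text \<open>
  This makes \<open>induced_tensor\<close> applicable to \<open>a \<odot> b\<close> at arbitrary arguments, not only at powers of
  a single vector.  A slot lies in one of the two factors, so in it the form is a linear form
  times a constant.
\<close>

lemma multilinear_form_product:
  fixes scale :: "'f::field_char_0 \<Rightarrow> 'v::ab_group_add \<Rightarrow> 'v"
  assumes vs: "vector_space scale"
    and a: "a \<in> lin_maps (Sym scale m) (*) UNIV" and b: "b \<in> lin_maps (Sym scale n) (*) UNIV"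
  shows "multilinear scale (*) (\<lambda>vs. if length vs = m + n
    then a (sym_tensor scale (take m vs)) * b (sym_tensor scale (drop m vs)) else 0)"
  unfolding multilinear_def
proof (intro allI)
  note ST = multilinear_sym_tensor[OF vs, unfolded multilinear_def, rule_format, THEN linearD(3)]
    multilinear_sym_tensor[OF vs, unfolded multilinear_def, rule_format, THEN linearD(4)]
  fix xs ys :: "'v list"
  have lin: "Vector_Spaces.linear scale (*) (\<lambda>v. l (sym_tensor scale (us @ v # ws)))"
    if "l \<in> lin_maps (Sym scale k) (*) UNIV" "Suc (length us + length ws) = k" for l k us ws
    using that
    by (intro linearI' vs vector_space_mult) (auto simp: ST lin_maps_def sym_tensor_in_Sym)
  interpret p: vector_space_pair scale "(*) :: 'f \<Rightarrow> 'f \<Rightarrow> 'f"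
    using vs vector_space_mult by (simp add: vector_space_pair_def)
  consider "Suc (length xs + length ys) \<noteq> m + n"
    | "Suc (length xs + length ys) = m + n" "length xs < m"
    | "Suc (length xs + length ys) = m + n" "m \<le> length xs"
    by linarith
  then show "Vector_Spaces.linear scale (*) (\<lambda>v. if length (xs @ v # ys) = m + n
    then a (sym_tensor scale (take m (xs @ v # ys))) * b (sym_tensor scale (drop m (xs @ v # ys)))
    else 0)"
  proof cases
    case 1
    then show ?thesis by (simp add: p.linear_zero)
  next
    case 2
    let ?c = "b (sym_tensor scale (drop (m - Suc (length xs)) ys))"
    have "Vector_Spaces.linear scale (*)
        (\<lambda>v. ?c * a (sym_tensor scale (xs @ v # take (m - Suc (length xs)) ys)))"
      using 2 by (intro p.linear_compose_scale_right lin[OF a]) simp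
    then show ?thesis using 2 by (simp add: take_Cons' drop_Cons' mult.commute)
  next
    case 3
    let ?c = "a (sym_tensor scale (take m xs))"
    have "Vector_Spaces.linear scale (*) (\<lambda>v. ?c * b (sym_tensor scale (drop m xs @ v # ys)))"
      using 3 by (intro p.linear_compose_scale_right lin[OF b]) simp
    then show ?thesis using 3 by simp
  qed
qed

text \<open>
  An enumeration of \<open>I\<close> cut after \<open>m\<close> entries is a subset \<open>J\<close> with \<open>m\<close> elements together with
  enumerations of \<open>J\<close> and of its complement.
\<close>

lemma sum_enumerations_cut:
  fixes h :: "'a set \<Rightarrow> 'a set \<Rightarrow> 'f::field_char_0"
  assumes I: "finite I" and m: "m \<le> card I"
  shows "(\<Sum>ys\<in>permutations_of_set I. h (set (take m ys)) (set (drop m ys))) =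
    (\<Sum>J | J \<in> Pow I \<and> card J = m. fact m * fact (card I - m) * h J (I - J))"
proof -
  let ?D = "SIGMA J:{J \<in> Pow I. card J = m}. permutations_of_set J \<times> permutations_of_set (I - J)"
  have "(\<Sum>ys\<in>permutations_of_set I. h (set (take m ys)) (set (drop m ys))) =
      (\<Sum>(J, p)\<in>?D. h J (I - J))"
  proof (rule sum.reindex_bij_witness[where i = "\<lambda>(J, xs, zs). xs @ zs"
        and j = "\<lambda>ys. (set (take m ys), take m ys, drop m ys)"])
    fix ys assume ys: "ys \<in> permutations_of_set I"
    then have d: "set ys = I" "distinct ys" "length ys = card I"
      by (auto dest: permutations_of_setD length_finite_permutations_of_set)
    have disj: "set (take m ys) \<inter> set (drop m ys) = {}"
      using d(2) by (simp add: set_take_disj_set_drop_if_distinct)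
    moreover have "set (take m ys) \<union> set (drop m ys) = I"
      using d(1) by (metis append_take_drop_id set_append)
    ultimately have D: "I - set (take m ys) = set (drop m ys)" "set (take m ys) \<subseteq> I"
      by auto
    show "(set (take m ys), take m ys, drop m ys) \<in> ?D"
      using d m D by (auto simp: distinct_card)
    show "(case (set (take m ys), take m ys, drop m ys) of (J, p) \<Rightarrow> h J (I - J)) =
        h (set (take m ys)) (set (drop m ys))"
      using D by simp
  next
    fix t assume "t \<in> ?D"
    then obtain J xs zs where t: "t = (J, xs, zs)" "J \<subseteq> I" "card J = m"
      "xs \<in> permutations_of_set J" "zs \<in> permutations_of_set (I - J)" by auto
    then have enum: "set xs = J" "distinct xs" "set zs = I - J" "distinct zs"
      by (auto dest: permutations_of_setD)
    then have len: "length xs = m"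
      using t(3) by (simp flip: distinct_card)
    from t enum show "(\<lambda>(J, xs, zs). xs @ zs) t \<in> permutations_of_set I"
      by (simp, intro permutations_of_setI) auto
    show "(\<lambda>ys. (set (take m ys), take m ys, drop m ys)) ((\<lambda>(J, xs, zs). xs @ zs) t) = t"
      using t enum len by simp
  qed auto
  also have "\<dots> = (\<Sum>J | J \<in> Pow I \<and> card J = m.
      \<Sum>p\<in>permutations_of_set J \<times> permutations_of_set (I - J). h J (I - J))"
    using I by (subst sum.Sigma) auto
  also have "\<dots> = (\<Sum>J | J \<in> Pow I \<and> card J = m. fact m * fact (card I - m) * h J (I - J))"
    using I
    by (intro sum.cong)
       (auto simp: card_cartesian_product card_Diff_subset finite_subset of_nat_fact)
  finally show ?thesis .
qed

lemma sym_prod_sym_tensor_on: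
  fixes scale :: "'f::field_char_0 \<Rightarrow> 'v::ab_group_add \<Rightarrow> 'v"
  assumes vs: "vector_space scale"
    and a: "a \<in> lin_maps (Sym scale m) (*) UNIV"
    and b: "b \<in> lin_maps (Sym scale (card I - m)) (*) UNIV"
    and I: "finite I" and m: "m \<le> card I"
  shows "fact (card I) * sym_prod scale m (card I - m) a b (sym_tensor_on scale I v) =
    (\<Sum>J | J \<in> Pow I \<and> card J = m.
      fact m * fact (card I - m) * (a (sym_tensor_on scale J v) * b (sym_tensor_on scale (I - J) v)))"
proof -
  let ?\<Phi> = "\<lambda>vs. a (sym_tensor scale (take m vs)) * b (sym_tensor scale (drop m vs))"
  have "fact (card I) * sym_prod scale m (card I - m) a b (sym_tensor_on scale I v) =
      (\<Sum>ys\<in>permutations_of_set I. ?\<Phi> (map v ys))"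
    using induced_sym_tensor_on[of scale I ?\<Phi> v] multilinear_form_product[OF vs a b] I m
    by (simp add: sym_prod_def)
  also have "\<dots> = (\<Sum>ys\<in>permutations_of_set I.
      a (sym_tensor_on scale (set (take m ys)) v) * b (sym_tensor_on scale (set (drop m ys)) v))"
    by (intro sum.cong refl)
       (auto dest: permutations_of_setD simp: take_map drop_map sym_tensor_eq_sym_tensor_on)
  also have "\<dots> = (\<Sum>J | J \<in> Pow I \<and> card J = m.
      fact m * fact (card I - m) * (a (sym_tensor_on scale J v) * b (sym_tensor_on scale (I - J) v)))"
    by (rule sum_enumerations_cut[OF I m])
  finally show ?thesis .
qed

section \<open>Power series as set functions\<close>

text \<open>
  With the factorial this is a polarised exponential generating function: if all \<open>v i\<close> equal a
  vector \<open>w\<close> and \<open>|I| = n\<close>, the value at \<open>I\<close> is the coefficient of \<open>t\<^sup>n / n!\<close> in \<open>A(t w)\<close>.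
\<close>

definition set_coeff ::
  "('f::field_char_0 \<Rightarrow> 'v::ab_group_add \<Rightarrow> 'v) \<Rightarrow> (nat \<Rightarrow> 'v) \<Rightarrow> ('v, 'f, 'f) tseries \<Rightarrow> nat set \<Rightarrow> 'f"
  where "set_coeff scale v A I = fact (card I) * A (card I) (sym_tensor_on scale I v)"

text \<open>
  The weight \<open>m! (n - m)!\<close> with which each subset of \<open>m\<close> elements occurs in the product is
  exactly the one built into the set functions of the two factors.
\<close>

lemma set_coeff_mult:
  fixes scale :: "'f::field_char_0 \<Rightarrow> 'v::ab_group_add \<Rightarrow> 'v"
  assumes vs: "vector_space scale"
    and A: "A \<in> tseries scale (*)" and B: "B \<in> tseries scale (*)" and I: "finite I"
  shows "set_coeff scale v (series_mult scale A B) I =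
    (\<Sum>J\<in>Pow I. set_coeff scale v A J * set_coeff scale v B (I - J))"
proof -
  have "set_coeff scale v (series_mult scale A B) I =
      (\<Sum>k\<le>card I. \<Sum>J | J \<in> Pow I \<and> card J = k. fact k * fact (card I - k) *
        (A k (sym_tensor_on scale J v) * B (card I - k) (sym_tensor_on scale (I - J) v)))"
    unfolding set_coeff_def series_mult_def sum_distrib_left
    using A B by (intro sum.cong refl sym_prod_sym_tensor_on vs I) (auto simp: tseries_def)
  also have "\<dots> = (\<Sum>k\<le>card I. \<Sum>J | J \<in> Pow I \<and> card J = k.
      set_coeff scale v A J * set_coeff scale v B (I - J))"
    using I
    by (intro sum.cong refl) (auto simp: set_coeff_def card_Diff_subset finite_subset)
  also have "\<dots> = (\<Sum>J\<in>Pow I. set_coeff scale v A J * set_coeff scale v B (I - J))"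
    using I by (intro sum.group) (auto intro: card_mono)
  finally show ?thesis .
qed

lemma set_coeff_one:
  fixes scale :: "'f::field_char_0 \<Rightarrow> 'v::ab_group_add \<Rightarrow> 'v"
  assumes vs: "vector_space scale" and I: "finite I"
  shows "set_coeff scale v series_one I = (if I = {} then 1 else 0)"
proof -
  interpret p: vector_space_pair scale "(*) :: 'f \<Rightarrow> 'f \<Rightarrow> 'f"
    using vs vector_space_mult by (simp add: vector_space_pair_def)
  have ml: "multilinear scale (*) (\<lambda>vs. if length vs = card ({}::nat set) then 1 else 0)"
    by (simp add: multilinear_def p.linear_zero)
  show ?thesis
    using I induced_sym_tensor_on[OF ml finite.emptyI, of v]
    by (auto simp: set_coeff_def series_one_def)
qed

lemma series_one_in_tseries: "series_one \<in> tseries scale (*)"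
  by (auto simp: tseries_def lin_maps_def series_one_def induced_def tscale_def)

text \<open>
  The coefficients of a product are sums of evaluations of tensors at fixed forms, and
  tensors add and scale pointwise.
\<close>

lemma series_mult_in_tseries: "series_mult scale A B \<in> tseries scale (*)"
  by (auto simp: tseries_def lin_maps_def series_mult_def sym_prod_def induced_def tscale_def
      sum.distrib sum_distrib_left)

lemma series_power_in_tseries: "series_power scale C k \<in> tseries scale (*)"
  by (cases k) (simp_all add: series_one_in_tseries series_mult_in_tseries)

section \<open>The exponential formula\<close>

text \<open>
  Double counting of the pairs of a partition of \<open>I\<close> into \<open>k + 1\<close> blocks and one of its
  blocks \<open>J\<close>: the remaining blocks form a partition of \<open>I - J\<close>, and there are \<open>k + 1\<close> choices
  of \<open>J\<close>.
\<close>

lemma sum_partitions_pick_block: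
  fixes g :: "'a set \<Rightarrow> 'f::comm_semiring_1"
  assumes I: "finite I"
  shows "(\<Sum>J\<in>Pow I - {{}}. g J * (\<Sum>\<pi> | partition_on (I - J) \<pi> \<and> card \<pi> = k. \<Prod>A\<in>\<pi>. g A)) =
    of_nat (Suc k) * (\<Sum>\<pi> | partition_on I \<pi> \<and> card \<pi> = Suc k. \<Prod>A\<in>\<pi>. g A)"
proof -
  let ?P = "\<lambda>I k. {\<pi>. partition_on I \<pi> \<and> card \<pi> = k}"
  have fin: "finite (?P I' k')" if "finite I'" for I' :: "'a set" and k'
    using finitely_many_partition_on[OF that] by (rule rev_finite_subset) auto
  have "(\<Sum>J\<in>Pow I - {{}}. g J * (\<Sum>\<pi>\<in>?P (I - J) k. \<Prod>A\<in>\<pi>. g A)) =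
      (\<Sum>(J, \<pi>)\<in>(SIGMA J:Pow I - {{}}. ?P (I - J) k). g J * (\<Prod>A\<in>\<pi>. g A))"
    using I fin unfolding sum_distrib_left by (subst sum.Sigma) auto
  also have "\<dots> = (\<Sum>(\<pi>, J)\<in>(SIGMA \<pi>:?P I (Suc k). \<pi>). \<Prod>A\<in>\<pi>. g A)"
  proof (rule sum.reindex_bij_witness[where i = "\<lambda>(\<pi>, J). (J, \<pi> - {J})"
        and j = "\<lambda>(J, \<pi>). (insert J \<pi>, J)"])
    fix t assume "t \<in> (SIGMA J:Pow I - {{}}. ?P (I - J) k)"
    then obtain J \<pi> where t: "t = (J, \<pi>)" "J \<subseteq> I" "J \<noteq> {}" "partition_on (I - J) \<pi>" "card \<pi> = k"
      by auto
    have fin\<pi>: "finite \<pi>" using I t(4) finite_elements by blast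
    have J: "J \<notin> \<pi>" using t(3,4) by (auto dest: partition_onD1)
    have "partition_on I (insert J \<pi>)"
      using t by (subst partition_on_insert) (auto simp: disjnt_def dest!: partition_onD1)
    then show "(\<lambda>(J, \<pi>). (insert J \<pi>, J)) t \<in> (SIGMA \<pi>:?P I (Suc k). \<pi>)"
      using t J fin\<pi> by simp
    show "(\<lambda>(\<pi>, J). (J, \<pi> - {J})) ((\<lambda>(J, \<pi>). (insert J \<pi>, J)) t) = t"
      using t J by simp
    show "(case (\<lambda>(J, \<pi>). (insert J \<pi>, J)) t of (\<pi>, J) \<Rightarrow> \<Prod>A\<in>\<pi>. g A) =
        (case t of (J, \<pi>) \<Rightarrow> g J * (\<Prod>A\<in>\<pi>. g A))"
      using t J fin\<pi> by simp
  next
    fix t assume "t \<in> (SIGMA \<pi>:?P I (Suc k). \<pi>)"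
    then obtain J \<pi> where t: "t = (\<pi>, J)" "partition_on I \<pi>" "card \<pi> = Suc k" "J \<in> \<pi>" by auto
    have J: "J \<noteq> {}" "J \<subseteq> I" using t(2,4) by (auto simp: partition_on_def)
    have "partition_on (I - J) (\<pi> - {J})"
      using t(2,4)
      by (intro partition_onI) (auto simp: partition_on_def disjnt_def pairwise_def)
    then show "(\<lambda>(\<pi>, J). (J, \<pi> - {J})) t \<in> (SIGMA J:Pow I - {{}}. ?P (I - J) k)"
      using t J by simp
    show "(\<lambda>(J, \<pi>). (insert J \<pi>, J)) ((\<lambda>(\<pi>, J). (J, \<pi> - {J})) t) = t"
      using t by auto
  qed
  also have "\<dots> = (\<Sum>\<pi>\<in>?P I (Suc k). \<Sum>J\<in>\<pi>. \<Prod>A\<in>\<pi>. g A)"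
    using I fin finite_elements by (subst sum.Sigma) auto
  also have "\<dots> = of_nat (Suc k) * (\<Sum>\<pi>\<in>?P I (Suc k). \<Prod>A\<in>\<pi>. g A)"
    unfolding sum_distrib_left by (intro sum.cong) auto
  finally show ?thesis .
qed

text \<open>
  One more factor of the power picks the subset \<open>J\<close> of labels that it receives.  As \<open>C\<close> has no
  constant term, \<open>J\<close> can be taken nonempty, and picking it produces the factor \<open>k + 1\<close> that
  extends \<open>k!\<close> to \<open>(k + 1)!\<close>.
\<close>

lemma set_coeff_power:
  fixes scale :: "'f::field_char_0 \<Rightarrow> 'v::ab_group_add \<Rightarrow> 'v"
  assumes vs: "vector_space scale" and C: "C \<in> tseries scale (*)" and C0: "const_term scale C = 0"
    and I: "finite I"
  shows "set_coeff scale v (series_power scale C k) I =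
    fact k * (\<Sum>\<pi> | partition_on I \<pi> \<and> card \<pi> = k. \<Prod>A\<in>\<pi>. set_coeff scale v C A)"
  using I
proof (induction k arbitrary: I)
  case 0
  have "{\<pi>. partition_on I \<pi> \<and> card \<pi> = 0} = (if I = {} then {{}} else {})"
    using finite_elements[OF 0] by (auto simp: partition_on_empty dest: partition_onD1)
  then show ?case using set_coeff_one[OF vs 0, of v] by simp
next
  case (Suc k)
  let ?g = "set_coeff scale v C"
  let ?S = "\<lambda>I k. \<Sum>\<pi> | partition_on I \<pi> \<and> card \<pi> = k. \<Prod>A\<in>\<pi>. ?g A"
  have g0: "?g {} = 0"
    using C0 sym_tensor_replicate[of scale 0]
    by (simp add: set_coeff_def sym_tensor_on_def const_term_def tpow_def)
  have "set_coeff scale v (series_power scale C (Suc k)) I =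
      (\<Sum>J\<in>Pow I. ?g J * set_coeff scale v (series_power scale C k) (I - J))"
    using set_coeff_mult[OF vs C series_power_in_tseries Suc.prems] by simp
  also have "\<dots> = (\<Sum>J\<in>Pow I. ?g J * (fact k * ?S (I - J) k))"
    using Suc by simp
  also have "\<dots> = (\<Sum>J\<in>Pow I - {{}}. ?g J * (fact k * ?S (I - J) k))"
    using Suc.prems g0 by (intro sum.mono_neutral_right) auto
  also have "\<dots> = fact k * (\<Sum>J\<in>Pow I - {{}}. ?g J * ?S (I - J) k)"
    by (simp add: sum_distrib_left mult.left_commute)
  also have "\<dots> = fact (Suc k) * ?S I (Suc k)"
    using sum_partitions_pick_block[OF Suc.prems, of ?g k]
    by (simp add: mult_ac)
  finally show ?case .
qed

text \<open>
  Grouping the partitions of \<open>I\<close> by their number of blocks, which is at most \<open>|I|\<close>, matches the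
  truncation of the exponential sum.
\<close>

theorem set_coeff_exp:
  fixes scale :: "'f::field_char_0 \<Rightarrow> 'v::ab_group_add \<Rightarrow> 'v"
  assumes vs: "vector_space scale" and C: "C \<in> tseries scale (*)" and C0: "const_term scale C = 0"
    and I: "finite I"
  shows "set_coeff scale v (series_exp scale C) I =
    (\<Sum>\<pi> | partition_on I \<pi>. \<Prod>A\<in>\<pi>. set_coeff scale v C A)"
proof -
  let ?g = "set_coeff scale v C"
  have blocks: "card \<pi> \<le> card I" if "partition_on I \<pi>" for \<pi>
  proof -
    have "card \<pi> = (\<Sum>A\<in>\<pi>. 1)" by simp
    also have "\<dots> \<le> (\<Sum>A\<in>\<pi>. card A)"
      using that I
      by (intro sum_mono) (metis One_nat_def Suc_leI Union_upper card_gt_0_iff finite_subset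
          partition_onD1 partition_onD3)
    also have "\<dots> = card I" using product_partition[OF that] that I
      by (metis Union_upper finite_subset partition_onD1)
    finally show ?thesis .
  qed
  have "set_coeff scale v (series_exp scale C) I =
      (\<Sum>k\<le>card I. set_coeff scale v (series_power scale C k) I / fact k)"
    by (simp add: set_coeff_def series_exp_def sum_distrib_left)
  also have "\<dots> = (\<Sum>k\<le>card I. \<Sum>\<pi> | \<pi> \<in> {\<pi>. partition_on I \<pi>} \<and> card \<pi> = k. \<Prod>A\<in>\<pi>. ?g A)"
    using set_coeff_power[OF vs C C0 I] by simp
  also have "\<dots> = (\<Sum>\<pi> | partition_on I \<pi>. \<Prod>A\<in>\<pi>. ?g A)"
    using blocks by (intro sum.group finitely_many_partition_on I) auto
  finally show ?thesis .
qed

section \<open>The Sheffer sequence\<close>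

lemma series_pairing_in_tseries:
  assumes "\<omega> \<in> dual scale" "B \<in> tseries scale scale"
  shows "series_pairing \<omega> B \<in> tseries scale (*)"
  using assms linearD(3,4)[of scale "(*)" \<omega>]
  by (auto simp: dual_def tseries_def lin_maps_def series_pairing_def)

lemma tseries_add:
  assumes "A \<in> tseries scale (*)" "B \<in> tseries scale (*)"
  shows "A + B \<in> tseries scale (*)"
  using assms by (auto simp: tseries_def lin_maps_def algebra_simps)

theorem corollary5p4:
  fixes scale :: "'f::real_normed_field \<Rightarrow> 'v::ab_group_add \<Rightarrow> 'v"
    and S :: "nat \<Rightarrow> ('v \<Rightarrow> 'f) \<Rightarrow> ('v, 'f) tensor \<Rightarrow> 'f"
    and B :: "('v, 'f, 'v) tseries"
    and \<alpha> :: "('v, 'f, 'f) tseries"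
  assumes "vector_space scale"
    and "sheffer_sequence scale S"
    and "exp_series scale B \<in> F1 scale"
    and "exp_series (*) \<alpha> \<in> tseries scale (*)"
    and "\<And>\<omega>. \<omega> \<in> dual scale \<Longrightarrow>
      series_eq scale (generating_function S \<omega>)
        (series_exp scale (series_pairing \<omega> (exp_series scale B) + exp_series (*) \<alpha>))"
  shows "(\<forall>\<omega>\<in>dual scale. \<forall>n\<ge>1. \<forall>v :: nat \<Rightarrow> 'v.
      S n \<omega> (sym_tensor_on scale {1..n} v) =
        (\<Sum>\<pi> | partition_on {1..n} \<pi>. \<Prod>A\<in>\<pi>.
          \<omega> (B (card A) (sym_tensor_on scale A v)) + \<alpha> (card A) (sym_tensor_on scale A v)))
    \<and> (\<forall>\<omega>\<in>dual scale. \<forall>v. \<forall>n\<ge>1.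
      S n \<omega> (tpow scale n v) =
        (\<Sum>\<pi> | partition_on {1..n} \<pi>. \<Prod>A\<in>\<pi>.
          \<omega> (B (card A) (tpow scale (card A) v)) + \<alpha> (card A) (tpow scale (card A) v)))"
proof -
  have main: "S n \<omega> (sym_tensor_on scale {1..n} v) =
      (\<Sum>\<pi> | partition_on {1..n} \<pi>. \<Prod>A\<in>\<pi>.
        \<omega> (B (card A) (sym_tensor_on scale A v)) + \<alpha> (card A) (sym_tensor_on scale A v))"
    if \<omega>: "\<omega> \<in> dual scale" for \<omega> n and v :: "nat \<Rightarrow> 'v"
  proof -
    let ?C = "series_pairing \<omega> (exp_series scale B) + exp_series (*) \<alpha>"
    have lin: "Vector_Spaces.linear scale (*) \<omega>" using \<omega> by (simp add: dual_def)
    have \<omega>0: "\<omega> 0 = 0" using linearD(3)[OF lin, of 0 0] by simp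
    have C: "?C \<in> tseries scale (*)"
      using assms(3,4) \<omega> by (intro tseries_add series_pairing_in_tseries) (auto simp: F1_def)
    have C0: "const_term scale ?C = 0"
      by (simp add: const_term_def series_pairing_def exp_series_def \<omega>0)
    have block: "set_coeff scale v ?C A =
        \<omega> (B (card A) (sym_tensor_on scale A v)) + \<alpha> (card A) (sym_tensor_on scale A v)"
      if "partition_on {1..n} \<pi>" "A \<in> \<pi>" for \<pi> A
    proof -
      have "A \<subseteq> {1..n}" "A \<noteq> {}" using that by (auto simp: partition_on_def)
      then have "card A \<noteq> 0" using finite_subset by fastforce
      then show ?thesis
        by (simp add: set_coeff_def series_pairing_def exp_series_def linearD(4)[OF lin]
            distrib_left)
    qed
    have "S n \<omega> (sym_tensor_on scale {1..n} v) =
        set_coeff scale v (generating_function S \<omega>) {1..n}"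
      by (simp add: set_coeff_def generating_function_def)
    also have "\<dots> = set_coeff scale v (series_exp scale ?C) {1..n}"
      using assms(5)[OF \<omega>] sym_tensor_on_in_Sym[of "{1..n}" scale v]
      by (simp add: set_coeff_def series_eq_def)
    also have "\<dots> = (\<Sum>\<pi> | partition_on {1..n} \<pi>. \<Prod>A\<in>\<pi>. set_coeff scale v ?C A)"
      by (rule set_coeff_exp[OF assms(1) C C0]) simp
    also have "\<dots> = (\<Sum>\<pi> | partition_on {1..n} \<pi>. \<Prod>A\<in>\<pi>.
        \<omega> (B (card A) (sym_tensor_on scale A v)) + \<alpha> (card A) (sym_tensor_on scale A v))"
      by (intro sum.cong prod.cong refl) (auto simp: block)
    finally show ?thesis .
  qed
  moreover have "S n \<omega> (tpow scale n v) =
      (\<Sum>\<pi> | partition_on {1..n} \<pi>. \<Prod>A\<in>\<pi>.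
        \<omega> (B (card A) (tpow scale (card A) v)) + \<alpha> (card A) (tpow scale (card A) v))"
    if "\<omega> \<in> dual scale" for \<omega> n v
    using main[OF that, of n "\<lambda>_. v"] by (simp add: sym_tensor_on_const)
  ultimately show ?thesis by blast
qed

end
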